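(* Let $(\mathcal{X},d)$ be a complete separable metric space and let $\mu,\nu\in\mathcal{P}(\mathcal{X})$. Then the function $\lambda\mapsto W^{(\lambda)}(\mu,\nu)$ is continuous and monotonically non-decreasing on $[0,\infty)$. Moreover, if $W_1(\mu,\nu)$ exists (i.e. is finite), then $$\lim_{\lambda\to\infty}W^{(\lambda)}(\mu,\nu)=W_1(\mu,\nu).$$
   Context: $\mathcal{P}(\mathcal{X})$ is the set of all Borel probability measures on $\mathcal{X}$; $\Pi(\mu,\nu)$ is the set of Borel probability measures on $\mathcal{X}\times\mathcal{X}$ with marginals $\mu$ and $\nu$. For $\lambda\ge 0$, $W^{(\lambda)}(\mu,\nu):=\inf_{\pi\in\Pi(\mu,\nu)}\int\min\{d(x,y),2\lambda\}\,d\pi(x,y)$ (robust Wasserstein distance), and $W_1(\mu,\nu):=\inf_{\pi\in\Pi(\mu,\nu)}\int d(x,y)\,d\pi(x,y)$. *)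

theory Defs
  imports "HOL-Probability.Probability"
begin

definition borel_probs :: "'a::topological_space measure set" where
  "borel_probs = {\<mu>. prob_space \<mu> \<and> sets \<mu> = sets borel}"

definition couplings ::
  "'a::topological_space measure \<Rightarrow> 'a measure \<Rightarrow> ('a \<times> 'a) measure set" where
  "couplings \<mu> \<nu> =
     {\<pi> \<in> borel_probs. distr \<pi> borel fst = \<mu> \<and> distr \<pi> borel snd = \<nu>}"

text \<open>The truncated cost is bounded, so for \<open>l \<ge> 0\<close> and probability measures on a Polish
  space the Bochner integrals and their infimum over the nonempty set of couplings are
  genuine real numbers.\<close>

definition robust_wasserstein ::
  "real \<Rightarrow> 'a::metric_space measure \<Rightarrow> 'a measure \<Rightarrow> real" where
  "robust_wasserstein l \<mu> \<nu> =
     (INF \<pi>\<in>couplings \<mu> \<nu>. LINT z|\<pi>. min (dist (fst z) (snd z)) (2 * l))"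

text \<open>The untruncated cost need not be integrable, hence the extended nonnegative integral:
  a Bochner integral would be 0 for a coupling of infinite cost.\<close>

definition wasserstein1 ::
  "'a::metric_space measure \<Rightarrow> 'a measure \<Rightarrow> ennreal" where
  "wasserstein1 \<mu> \<nu> =
     (INF \<pi>\<in>couplings \<mu> \<nu>. \<integral>\<^sup>+ z. ennreal (dist (fst z) (snd z)) \<partial>\<pi>)"

end

theory Submission
  imports Defs
begin

text \<open>
  Raising \<open>l\<close> by \<open>h\<close> raises the cost \<open>min d (2 l)\<close> pointwise by an amount between \<open>0\<close> and \<open>2 h\<close>.
  Integrating and taking infima preserves both bounds, so the robust distance is non-decreasing
  and 2-Lipschitz in \<open>l\<close>.  It never exceeds the Wasserstein distance, so the limit statement
  reduces to one claim (\<open>wasserstein1_le_if_robust_le\<close>): a bound \<open>w\<close> for all robust distances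
  also bounds the Wasserstein distance.

  That claim needs a coupling which is good for all truncation levels at once, extracted from
  near-optimal couplings \<open>\<pi> n\<close> for the levels \<open>n\<close>.  Weak compactness of the set of couplings
  would provide it, but since an error \<open>\<epsilon>\<close> in the cost is harmless, a discrete form of
  compactness is enough.  The space is cut into countably many Borel cells, each contained in a
  small ball, and a coupling is reduced to the matrix of masses that it gives to the products
  of two cells.

  By Tychonoff's theorem some subsequence of the matrices of the \<open>\<pi> n\<close> converges entrywise.  Every
  entry of a row is at most the \<open>\<nu>\<close>-mass of its column's cell, which is summable, so no mass
  escapes and by dominated convergence the limit matrix has the correct row sums; columns are
  symmetric.  Such a matrix is the cell matrix of a genuine coupling
  (\<open>exists_coupling_with_cell_masses\<close>).  By Fatou's lemma for sums the discretised cost of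
  the limit coupling is at most the lower limit of the discretised truncated costs, because each
  truncated entry eventually equals the untruncated one.  Discretisation changes costs only by
  twice the radius of the cells.
\<close>

section \<open>Countably many fibres\<close>

lemma nn_integral_fibres:
  fixes K :: "'b \<Rightarrow> 'c::countable"
  assumes K: "K \<in> M \<rightarrow>\<^sub>M count_space UNIV"
  shows "(\<integral>\<^sup>+x. f (K x) \<partial>M) = (\<integral>\<^sup>+i. emeasure M (K -` {i} \<inter> space M) * f i \<partial>count_space UNIV)"
proof -
  have "distr M (count_space UNIV) K
      = density (count_space UNIV) (\<lambda>i. emeasure M (K -` {i} \<inter> space M))"
    by (rule measure_eqI_countable[where A = UNIV])
      (auto simp: emeasure_distr[OF K] emeasure_density)
  then have "(\<integral>\<^sup>+x. f x \<partial>distr M (count_space UNIV) K)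
     = (\<integral>\<^sup>+i. emeasure M (K -` {i} \<inter> space M) * f i \<partial>count_space UNIV)"
    by (simp add: nn_integral_density)
  then show ?thesis
    by (simp add: nn_integral_distr[OF K])
qed

lemma AE_fibre_not_null:
  fixes K :: "'b \<Rightarrow> 'c::countable"
  assumes [measurable]: "K \<in> M \<rightarrow>\<^sub>M count_space UNIV"
  shows "AE x in M. emeasure M (K -` {K x} \<inter> space M) \<noteq> 0"
proof -
  have "AE x in M. K x = i \<longrightarrow> emeasure M (K -` {i} \<inter> space M) \<noteq> 0" for i
  proof (cases "emeasure M (K -` {i} \<inter> space M) = 0")
    case True
    then show ?thesis
      by (intro AE_I'[where N="K -` {i} \<inter> space M"]) (auto simp: null_sets_def)
  qed simp
  then have "AE x in M. \<forall>i. K x = i \<longrightarrow> emeasure M (K -` {i} \<inter> space M) \<noteq> 0"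
    by (subst AE_all_countable) blast
  then show ?thesis by eventually_elim blast
qed

section \<open>Entrywise convergent subsequences\<close>

text \<open>
  The cube is compact by Tychonoff's theorem and, because there are only countably many
  coordinates, metrizable; hence it is sequentially compact.
\<close>

lemma pointwise_convergent_subsequence:
  fixes p :: "nat \<Rightarrow> 'c::countable \<Rightarrow> real"
  assumes "\<And>n c. p n c \<in> {0..1}"
  obtains r q where "strict_mono r" "\<And>c. (\<lambda>n. p (r n) c) \<longlonglongrightarrow> q c"
proof -
  have "compactin (product_topology (\<lambda>_. euclidean) UNIV) (PiE UNIV (\<lambda>_::'c. {0..1::real}))"
    by (subst compactin_PiE) (auto simp: compactin_euclidean_iff)
  then have "compact (PiE UNIV (\<lambda>_::'c. {0..1::real}))"
    by (simp add: euclidean_product_topology flip: compactin_euclidean_iff)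
  then have "seq_compact (PiE UNIV (\<lambda>_::'c. {0..1::real}))"
    by (rule compact_imp_seq_compact)
  moreover have "\<forall>n. p n \<in> PiE UNIV (\<lambda>_. {0..1})"
    using assms by auto
  ultimately obtain q r where "strict_mono (r::nat \<Rightarrow> nat)" "(p \<circ> r) \<longlonglongrightarrow> q"
    by (rule seq_compactE)
  then have "\<And>c. (\<lambda>n. p (r n) c) \<longlonglongrightarrow> q c"
    using continuous_on_tendsto_compose[OF continuous_on_product_coordinates] by (fastforce simp: o_def)
  with \<open>strict_mono r\<close> show ?thesis by (rule that)
qed

section \<open>Lifting a discrete coupling\<close>

text \<open>
  Here \<open>p\<close> is one row (or column) of a discrete coupling and \<open>s\<close> its sum.  On a cell of mass
  \<open>b\<close> the constant \<open>p / (s * b)\<close> integrates to \<open>p / s\<close>, and the row adds up to \<open>1\<close>.  A cell of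
  mass \<open>0\<close> carries no mass of the row, so that \<open>0 / 0 = 0\<close> gives the right value there.
\<close>

lemma cell_density_marginal:
  fixes p :: "nat \<Rightarrow> ennreal" and k :: "'a \<Rightarrow> nat"
  assumes N: "finite_measure N" and k: "k \<in> N \<rightarrow>\<^sub>M count_space UNIV"
    and p: "\<And>j. p j \<le> emeasure N (k -` {j} \<inter> space N)"
    and s: "(\<integral>\<^sup>+j. p j \<partial>count_space UNIV) = s" and "s \<noteq> 0" "s \<noteq> \<infinity>"
  shows "(\<integral>\<^sup>+y. p (k y) / (s * emeasure N (k -` {k y} \<inter> space N)) \<partial>N) = 1"
proof -
  let ?b = "\<lambda>j. emeasure N (k -` {j} \<inter> space N)"
  have fin: "?b j \<noteq> \<infinity>" for j
    using N by (simp add: finite_measure.emeasure_finite)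
  have "(\<integral>\<^sup>+y. p (k y) / (s * ?b (k y)) \<partial>N) = (\<integral>\<^sup>+j. ?b j * (p j / (s * ?b j)) \<partial>count_space UNIV)"
    by (rule nn_integral_fibres[OF k])
  also have "\<dots> = (\<integral>\<^sup>+j. p j / s \<partial>count_space UNIV)"
  proof (rule nn_integral_cong)
    fix j
    show "?b j * (p j / (s * ?b j)) = p j / s"
    proof (cases "?b j = 0")
      case True
      then show ?thesis using p[of j] by simp
    next
      case False
      then show ?thesis
        using ennreal_mult_divide_eq[of "?b j" "p j / s"] fin[of j] \<open>s \<noteq> 0\<close> \<open>s \<noteq> \<infinity>\<close>
        by (simp add: divide_ennreal_def ennreal_inverse_mult' ac_simps less_top)
    qed
  qed
  also have "\<dots> = s / s"
    by (simp add: nn_integral_divide s)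
  also have "\<dots> = 1" using \<open>s \<noteq> 0\<close> \<open>s \<noteq> \<infinity>\<close> by (simp add: ennreal_divide_self less_top)
  finally show ?thesis .
qed

section \<open>Couplings and their cell masses\<close>

lemma borel_probsD: "\<mu> \<in> borel_probs \<Longrightarrow> prob_space \<mu>" "\<mu> \<in> borel_probs \<Longrightarrow> sets \<mu> = sets borel"
  "\<mu> \<in> borel_probs \<Longrightarrow> space \<mu> = UNIV"
  by (auto simp: borel_probs_def dest: sets_eq_imp_space_eq)

lemma couplingsD:
  fixes \<mu> \<nu> :: "'a::second_countable_topology measure"
  assumes "\<pi> \<in> couplings \<mu> \<nu>"
  shows "prob_space \<pi>" "sets \<pi> = sets borel" "space \<pi> = UNIV"
    and "A \<in> sets borel \<Longrightarrow> emeasure \<pi> (A \<times> UNIV) = emeasure \<mu> A"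
    and "A \<in> sets borel \<Longrightarrow> emeasure \<pi> (UNIV \<times> A) = emeasure \<nu> A"
    and "A \<in> sets borel \<Longrightarrow> B \<in> sets borel \<Longrightarrow> A \<times> B \<in> sets \<pi>"
proof -
  have \<pi>: "\<pi> \<in> borel_probs" and marg: "distr \<pi> borel fst = \<mu>" "distr \<pi> borel snd = \<nu>"
    using assms by (auto simp: couplings_def)
  show "prob_space \<pi>" and [simp, measurable_cong]: "sets \<pi> = sets borel" and [simp]: "space \<pi> = UNIV"
    using borel_probsD[OF \<pi>] by auto
  have [measurable]: "fst \<in> \<pi> \<rightarrow>\<^sub>M (borel :: 'a measure)" "snd \<in> \<pi> \<rightarrow>\<^sub>M (borel :: 'a measure)"
    by (simp_all add: measurable_cong_sets[of \<pi> "borel \<Otimes>\<^sub>M borel"] borel_prod[symmetric])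
  show "emeasure \<pi> (A \<times> UNIV) = emeasure \<mu> A" if "A \<in> sets borel"
    using that by (simp add: emeasure_distr vimage_fst flip: marg(1))
  show "emeasure \<pi> (UNIV \<times> A) = emeasure \<nu> A" if "A \<in> sets borel"
    using that by (simp add: emeasure_distr vimage_snd flip: marg(2))
  show "A \<times> B \<in> sets \<pi>" if "A \<in> sets borel" "B \<in> sets borel"
    using that by (simp flip: borel_prod)
qed

text \<open>
  Inside each product cell the coupling is a multiple of \<open>\<mu> \<Otimes> \<nu>\<close>, the factor being chosen so
  that the cell receives its prescribed mass.  The row and column sums make both marginals
  correct.  Hence any discrete coupling of the cell masses lifts to a coupling of \<open>\<mu>\<close> and \<open>\<nu>\<close>,
  and limits of couplings can be built from limits of matrices.
\<close>

lemma exists_coupling_with_cell_masses: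
  fixes \<mu> \<nu> :: "'a::second_countable_topology measure" and k :: "'a \<Rightarrow> nat"
  assumes \<mu>: "\<mu> \<in> borel_probs" and \<nu>: "\<nu> \<in> borel_probs"
    and k[measurable]: "k \<in> borel \<rightarrow>\<^sub>M count_space UNIV"
    and row: "\<And>i. (\<integral>\<^sup>+j. p i j \<partial>count_space UNIV) = emeasure \<mu> (k -` {i})"
    and col: "\<And>j. (\<integral>\<^sup>+i. p i j \<partial>count_space UNIV) = emeasure \<nu> (k -` {j})"
  obtains \<pi> where "\<pi> \<in> couplings \<mu> \<nu>" "\<forall>i j. emeasure \<pi> (k -` {i} \<times> k -` {j}) = p i j"
proof -
  interpret \<mu>: prob_space \<mu> using \<mu> by (rule borel_probsD)
  interpret \<nu>: prob_space \<nu> using \<nu> by (rule borel_probsD)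
  interpret P: pair_prob_space \<mu> \<nu> ..
  note [simp, measurable_cong] = borel_probsD(2)[OF \<mu>] borel_probsD(2)[OF \<nu>]
  note [simp] = borel_probsD(3)[OF \<mu>] borel_probsD(3)[OF \<nu>]
  define a where "a i = emeasure \<mu> (k -` {i})" for i
  define b where "b j = emeasure \<nu> (k -` {j})" for j
  have k_cell[measurable]: "k -` {i} \<in> sets borel" for i
    using measurable_sets[OF k, of "{i}"] by simp
  have fin: "a i \<noteq> \<infinity>" "b i \<noteq> \<infinity>" for i by (simp_all add: a_def b_def)
  have pa: "p i j \<le> a i" for i j
    unfolding a_def row[symmetric] by (rule nn_integral_ge_point) simp
  have pb: "p i j \<le> b j" for i j
    unfolding b_def col[symmetric] by (rule nn_integral_ge_point) simp
  have AEa: "AE x in \<mu>. a (k x) \<noteq> 0" and AEb: "AE y in \<nu>. b (k y) \<noteq> 0"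
    using AE_fibre_not_null[of k \<mu>] AE_fibre_not_null[of k \<nu>] by (simp_all add: a_def b_def)
  define g where "g = (\<lambda>z. p (k (fst z)) (k (snd z)) / (a (k (fst z)) * b (k (snd z))))"
  have [measurable]: "g \<in> borel_measurable (\<mu> \<Otimes>\<^sub>M \<nu>)"
    unfolding g_def by measurable
  define \<pi> where "\<pi> = density (\<mu> \<Otimes>\<^sub>M \<nu>) g"
  have sets_pair: "sets (\<mu> \<Otimes>\<^sub>M \<nu>) = sets (borel \<Otimes>\<^sub>M borel)"
    by (rule sets_pair_measure_cong) simp_all
  have sets_\<pi>[simp, measurable_cong]: "sets \<pi> = sets borel"
    unfolding \<pi>_def sets_density sets_pair by (simp only: borel_prod)
  have [simp]: "space \<pi> = UNIV" using sets_eq_imp_space_eq[OF sets_\<pi>] by simp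
  have [measurable]: "fst \<in> \<pi> \<rightarrow>\<^sub>M (borel :: 'a measure)" "snd \<in> \<pi> \<rightarrow>\<^sub>M (borel :: 'a measure)"
    by (simp_all add: measurable_cong_sets[of \<pi> "borel \<Otimes>\<^sub>M borel"] borel_prod[symmetric])
  have marg1: "emeasure (distr \<pi> borel fst) A = emeasure \<mu> A" if [measurable]: "A \<in> sets borel" for A
  proof -
    have "emeasure (distr \<pi> borel fst) A = (\<integral>\<^sup>+z. g z * indicator A (fst z) \<partial>(\<mu> \<Otimes>\<^sub>M \<nu>))"
    proof -
      have "emeasure (distr \<pi> borel fst) A = emeasure \<pi> (A \<times> UNIV)"
        by (simp add: emeasure_distr vimage_fst)
      also have "\<dots> = (\<integral>\<^sup>+z. g z * indicator (A \<times> UNIV) z \<partial>(\<mu> \<Otimes>\<^sub>M \<nu>))"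
        unfolding \<pi>_def by (rule emeasure_density) measurable
      finally show ?thesis by (simp add: indicator_def mem_Times_iff)
    qed
    also have "\<dots> = (\<integral>\<^sup>+x. (\<integral>\<^sup>+y. g (x, y) * indicator A x \<partial>\<nu>) \<partial>\<mu>)"
      by (subst \<nu>.nn_integral_fst[symmetric]) auto
    also have "\<dots> = (\<integral>\<^sup>+x. indicator A x \<partial>\<mu>)"
    proof (rule nn_integral_cong_AE, use AEa in eventually_elim)
      fix x assume "a (k x) \<noteq> 0"
      then have "(\<integral>\<^sup>+y. g (x, y) \<partial>\<nu>) = 1"
        using cell_density_marginal[of \<nu> k "p (k x)" "a (k x)"] \<nu>.finite_measure_axioms pb fin row
        by (simp add: g_def a_def b_def)
      then show "(\<integral>\<^sup>+y. g (x, y) * indicator A x \<partial>\<nu>) = indicator A x"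
        by (simp add: nn_integral_multc)
    qed
    also have "\<dots> = emeasure \<mu> A" by simp
    finally show ?thesis .
  qed
  have marg2: "emeasure (distr \<pi> borel snd) A = emeasure \<nu> A" if [measurable]: "A \<in> sets borel" for A
  proof -
    have "emeasure (distr \<pi> borel snd) A = (\<integral>\<^sup>+z. g z * indicator A (snd z) \<partial>(\<mu> \<Otimes>\<^sub>M \<nu>))"
    proof -
      have "emeasure (distr \<pi> borel snd) A = emeasure \<pi> (UNIV \<times> A)"
        by (simp add: emeasure_distr vimage_snd)
      also have "\<dots> = (\<integral>\<^sup>+z. g z * indicator (UNIV \<times> A) z \<partial>(\<mu> \<Otimes>\<^sub>M \<nu>))"
        unfolding \<pi>_def by (rule emeasure_density) measurable
      finally show ?thesis by (simp add: indicator_def mem_Times_iff)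
    qed
    also have "\<dots> = (\<integral>\<^sup>+y. (\<integral>\<^sup>+x. g (x, y) * indicator A y \<partial>\<mu>) \<partial>\<nu>)"
      by (subst P.nn_integral_snd[symmetric]) auto
    also have "\<dots> = (\<integral>\<^sup>+y. indicator A y \<partial>\<nu>)"
    proof (rule nn_integral_cong_AE, use AEb in eventually_elim)
      fix y assume "b (k y) \<noteq> 0"
      then have "(\<integral>\<^sup>+x. g (x, y) \<partial>\<mu>) = 1"
        using cell_density_marginal[of \<mu> k "\<lambda>i. p i (k y)" "b (k y)"] \<mu>.finite_measure_axioms pa fin col
        by (simp add: g_def a_def b_def mult.commute)
      then show "(\<integral>\<^sup>+x. g (x, y) * indicator A y \<partial>\<mu>) = indicator A y"
        by (simp add: nn_integral_multc)
    qed
    also have "\<dots> = emeasure \<nu> A" by simp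
    finally show ?thesis .
  qed
  have d1: "distr \<pi> borel fst = \<mu>" by (rule measure_eqI) (auto simp: marg1)
  have d2: "distr \<pi> borel snd = \<nu>" by (rule measure_eqI) (auto simp: marg2)
  have "emeasure \<pi> (space \<pi>) = 1"
    using marg1[of UNIV] \<mu>.emeasure_space_1 by (simp add: emeasure_distr)
  then have "\<pi> \<in> couplings \<mu> \<nu>"
    by (auto simp: couplings_def borel_probs_def d1 d2 intro: prob_spaceI)
  moreover have "emeasure \<pi> (k -` {i} \<times> k -` {j}) = p i j" for i j
  proof -
    have "emeasure \<pi> (k -` {i} \<times> k -` {j})
        = (\<integral>\<^sup>+z. p i j / (a i * b j) * indicator (k -` {i} \<times> k -` {j}) z \<partial>(\<mu> \<Otimes>\<^sub>M \<nu>))"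
      by (auto simp: \<pi>_def emeasure_density g_def intro!: nn_integral_cong split: split_indicator)
    also have "\<dots> = p i j / (a i * b j) * (a i * b j)"
      by (simp add: nn_integral_cmult_indicator \<nu>.emeasure_pair_measure_Times a_def b_def)
    also have "\<dots> = p i j"
    proof (cases "a i = 0 \<or> b j = 0")
      case True
      then show ?thesis using pa[of i j] pb[of i j] by auto
    next
      case False
      then have "a i * b j / (a i * b j) = 1"
        using fin[of i] fin[of j]
        by (intro ennreal_divide_self) (auto simp: ennreal_mult_less_top less_top)
      then show ?thesis by (simp add: ennreal_divide_times)
    qed
    finally show ?thesis .
  qed
  ultimately show ?thesis using that by blast
qed

lemma sum_coupling_cells:
  fixes \<mu> \<nu> :: "'a::second_countable_topology measure" and k :: "'a \<Rightarrow> nat"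
  assumes \<pi>: "\<pi> \<in> couplings \<mu> \<nu>" and k: "k \<in> borel \<rightarrow>\<^sub>M count_space UNIV"
  shows "(\<integral>\<^sup>+j. emeasure \<pi> (k -` {i} \<times> k -` {j}) \<partial>count_space UNIV) = emeasure \<mu> (k -` {i})"
    and "(\<integral>\<^sup>+i. emeasure \<pi> (k -` {i} \<times> k -` {j}) \<partial>count_space UNIV) = emeasure \<nu> (k -` {j})"
proof -
  have cell: "k -` {i} \<in> sets borel" for i
    using measurable_sets[OF k, of "{i}"] by simp
  have "(\<integral>\<^sup>+j. emeasure \<pi> (k -` {i} \<times> k -` {j}) \<partial>count_space UNIV)
      = emeasure \<pi> (\<Union>j. k -` {i} \<times> k -` {j})"
    using couplingsD(6)[OF \<pi> cell cell]
    by (intro emeasure_UN_countable[symmetric]) (auto simp: disjoint_family_on_def)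
  also have "(\<Union>j. k -` {i} \<times> k -` {j}) = k -` {i} \<times> UNIV" by auto
  finally show "(\<integral>\<^sup>+j. emeasure \<pi> (k -` {i} \<times> k -` {j}) \<partial>count_space UNIV) = emeasure \<mu> (k -` {i})"
    by (simp add: couplingsD(4)[OF \<pi>] cell)
  have "(\<integral>\<^sup>+i. emeasure \<pi> (k -` {i} \<times> k -` {j}) \<partial>count_space UNIV)
      = emeasure \<pi> (\<Union>i. k -` {i} \<times> k -` {j})"
    using couplingsD(6)[OF \<pi> cell cell]
    by (intro emeasure_UN_countable[symmetric]) (auto simp: disjoint_family_on_def)
  also have "(\<Union>i. k -` {i} \<times> k -` {j}) = UNIV \<times> k -` {j}" by auto
  finally show "(\<integral>\<^sup>+i. emeasure \<pi> (k -` {i} \<times> k -` {j}) \<partial>count_space UNIV) = emeasure \<nu> (k -` {j})"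
    by (simp add: couplingsD(5)[OF \<pi>] cell)
qed

lemma nn_integral_coupling_cells:
  fixes \<mu> \<nu> :: "'a::second_countable_topology measure" and k :: "'a \<Rightarrow> nat"
  assumes \<pi>: "\<pi> \<in> couplings \<mu> \<nu>" and k: "k \<in> borel \<rightarrow>\<^sub>M count_space UNIV"
  shows "(\<integral>\<^sup>+z. h (k (fst z)) (k (snd z)) \<partial>\<pi>)
    = (\<integral>\<^sup>+c. emeasure \<pi> (k -` {fst c} \<times> k -` {snd c}) * h (fst c) (snd c) \<partial>count_space UNIV)"
    and "(\<lambda>z. h (k (fst z)) (k (snd z))) \<in> borel_measurable \<pi>"
proof -
  have cell: "k -` {i} \<in> sets borel" for i
    using measurable_sets[OF k, of "{i}"] by simp
  define K where "K z = (k (fst z), k (snd z))" for z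
  have K_vimage: "K -` {c} = k -` {fst c} \<times> k -` {snd c}" for c
    by (auto simp: K_def)
  have K: "K \<in> \<pi> \<rightarrow>\<^sub>M count_space UNIV"
    using couplingsD(6)[OF \<pi> cell cell]
    by (simp add: measurable_count_space_eq2_countable K_vimage couplingsD(3)[OF \<pi>])
  show "(\<integral>\<^sup>+z. h (k (fst z)) (k (snd z)) \<partial>\<pi>)
    = (\<integral>\<^sup>+c. emeasure \<pi> (k -` {fst c} \<times> k -` {snd c}) * h (fst c) (snd c) \<partial>count_space UNIV)"
    using nn_integral_fibres[OF K, of "\<lambda>c. h (fst c) (snd c)"]
    by (simp add: K_vimage couplingsD(3)[OF \<pi>]) (simp add: K_def)
  show "(\<lambda>z. h (k (fst z)) (k (snd z))) \<in> borel_measurable \<pi>"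
    using measurable_compose[OF K, of "\<lambda>c. h (fst c) (snd c)" borel] by (simp add: K_def)
qed

text \<open>With a single cell the lifted coupling is the product measure.\<close>

lemma couplings_nonempty:
  fixes \<mu> \<nu> :: "'a::second_countable_topology measure"
  assumes "\<mu> \<in> borel_probs" "\<nu> \<in> borel_probs"
  shows "couplings \<mu> \<nu> \<noteq> {}"
proof -
  have one: "emeasure \<mu> UNIV = 1" "emeasure \<nu> UNIV = 1"
    using assms borel_probsD prob_space.emeasure_space_1 by metis+
  have "emeasure \<mu> ((\<lambda>_. 0::nat) -` {i}) = indicator {0} i"
       "emeasure \<nu> ((\<lambda>_. 0::nat) -` {i}) = indicator {0} i" for i
    by (cases "i = 0"; simp add: one)+
  then obtain \<pi> where "\<pi> \<in> couplings \<mu> \<nu>"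
    by (rule_tac exists_coupling_with_cell_masses[OF assms,
          where k="\<lambda>_. 0" and p="\<lambda>i j. indicator {0} i * indicator {0} j"])
       (simp_all add: nn_integral_cmult nn_integral_multc)
  then show ?thesis by blast
qed

section \<open>Monotonicity and Lipschitz continuity\<close>

lemma truncated_cost:
  fixes \<mu> \<nu> :: "'a::{metric_space, second_countable_topology} measure" and l :: real
  assumes \<pi>: "\<pi> \<in> couplings \<mu> \<nu>" and l: "l \<ge> 0"
  shows "(\<lambda>z. dist (fst z) (snd z)) \<in> borel_measurable \<pi>"
    and "integrable \<pi> (\<lambda>z. min (dist (fst z) (snd z)) (2 * l))"
    and "(\<integral>\<^sup>+z. ennreal (min (dist (fst z) (snd z)) (2 * l)) \<partial>\<pi>)
        = ennreal (LINT z|\<pi>. min (dist (fst z) (snd z)) (2 * l))"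
proof -
  interpret prob_space \<pi> using \<pi> by (rule couplingsD)
  show [measurable]: "(\<lambda>z. dist (fst z) (snd z)) \<in> borel_measurable \<pi>"
    by (subst measurable_cong_sets[OF couplingsD(2)[OF \<pi>] refl])
       (intro borel_measurable_continuous_onI continuous_intros)
  show int: "integrable \<pi> (\<lambda>z. min (dist (fst z) (snd z)) (2 * l))"
    using l by (intro integrable_const_bound[where B="2 * l"]) auto
  show "(\<integral>\<^sup>+z. ennreal (min (dist (fst z) (snd z)) (2 * l)) \<partial>\<pi>)
        = ennreal (LINT z|\<pi>. min (dist (fst z) (snd z)) (2 * l))"
    using l by (intro nn_integral_eq_integral int) auto
qed

lemma robust_wasserstein_le_cost:
  fixes \<mu> \<nu> :: "'a::{metric_space, second_countable_topology} measure" and l :: real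
  assumes "\<pi> \<in> couplings \<mu> \<nu>" and "l \<ge> 0"
  shows "robust_wasserstein l \<mu> \<nu> \<le> (LINT z|\<pi>. min (dist (fst z) (snd z)) (2 * l))"
  unfolding robust_wasserstein_def using assms
  by (intro cINF_lower bdd_belowI2[where m=0] integral_nonneg_AE) auto

lemma robust_wasserstein_nonneg:
  fixes \<mu> \<nu> :: "'a::{metric_space, second_countable_topology} measure" and l :: real
  assumes "\<mu> \<in> borel_probs" "\<nu> \<in> borel_probs" "l \<ge> 0"
  shows "0 \<le> robust_wasserstein l \<mu> \<nu>"
  unfolding robust_wasserstein_def using assms(3)
  by (intro cINF_greatest couplings_nonempty[OF assms(1,2)] integral_nonneg_AE) auto

lemma robust_wasserstein_mono:
  fixes \<mu> \<nu> :: "'a::{metric_space, second_countable_topology} measure" and l l' :: real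
  assumes "\<mu> \<in> borel_probs" "\<nu> \<in> borel_probs" and l: "0 \<le> l" "l \<le> l'"
  shows "robust_wasserstein l \<mu> \<nu> \<le> robust_wasserstein l' \<mu> \<nu>"
  unfolding robust_wasserstein_def[of l']
proof (rule cINF_greatest[OF couplings_nonempty[OF assms(1,2)]])
  fix \<pi> assume \<pi>: "\<pi> \<in> couplings \<mu> \<nu>"
  have "robust_wasserstein l \<mu> \<nu> \<le> (LINT z|\<pi>. min (dist (fst z) (snd z)) (2 * l))"
    using \<pi> l by (intro robust_wasserstein_le_cost) auto
  also have "\<dots> \<le> (LINT z|\<pi>. min (dist (fst z) (snd z)) (2 * l'))"
    using l by (intro integral_mono truncated_cost(2)[OF \<pi>]) auto
  finally show "robust_wasserstein l \<mu> \<nu> \<le> (LINT z|\<pi>. min (dist (fst z) (snd z)) (2 * l'))" .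
qed

text \<open>Any coupling that is good at level \<open>l\<close> costs at most \<open>2 * (l' - l)\<close> more at level \<open>l'\<close>.\<close>

lemma robust_wasserstein_increment:
  fixes \<mu> \<nu> :: "'a::{metric_space, second_countable_topology} measure" and l l' :: real
  assumes "\<mu> \<in> borel_probs" "\<nu> \<in> borel_probs" and l: "0 \<le> l" "l \<le> l'"
  shows "robust_wasserstein l' \<mu> \<nu> \<le> robust_wasserstein l \<mu> \<nu> + 2 * (l' - l)"
proof -
  have "robust_wasserstein l' \<mu> \<nu> - 2 * (l' - l) \<le> robust_wasserstein l \<mu> \<nu>"
    unfolding robust_wasserstein_def[of l]
  proof (rule cINF_greatest[OF couplings_nonempty[OF assms(1,2)]])
    fix \<pi> assume \<pi>: "\<pi> \<in> couplings \<mu> \<nu>"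
    interpret prob_space \<pi> using \<pi> by (rule couplingsD)
    note int = truncated_cost(2)[OF \<pi>]
    have "robust_wasserstein l' \<mu> \<nu> \<le> (LINT z|\<pi>. min (dist (fst z) (snd z)) (2 * l'))"
      using \<pi> l by (intro robust_wasserstein_le_cost) auto
    also have "\<dots> \<le> (LINT z|\<pi>. min (dist (fst z) (snd z)) (2 * l) + 2 * (l' - l))"
      using l by (intro integral_mono int Bochner_Integration.integrable_add) auto
    also have "\<dots> = (LINT z|\<pi>. min (dist (fst z) (snd z)) (2 * l)) + 2 * (l' - l)"
      using l int[of l] by (simp add: prob_space)
    finally show "robust_wasserstein l' \<mu> \<nu> - 2 * (l' - l)
        \<le> (LINT z|\<pi>. min (dist (fst z) (snd z)) (2 * l))" by simp
  qed
  then show ?thesis by simp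
qed

lemma robust_wasserstein_le_wasserstein1:
  fixes \<mu> \<nu> :: "'a::{metric_space, second_countable_topology} measure" and l :: real
  assumes l: "0 \<le> l"
  shows "ennreal (robust_wasserstein l \<mu> \<nu>) \<le> wasserstein1 \<mu> \<nu>"
  unfolding wasserstein1_def
proof (rule INF_greatest)
  fix \<pi> assume \<pi>: "\<pi> \<in> couplings \<mu> \<nu>"
  have "ennreal (robust_wasserstein l \<mu> \<nu>)
      \<le> (\<integral>\<^sup>+z. ennreal (min (dist (fst z) (snd z)) (2 * l)) \<partial>\<pi>)"
    unfolding truncated_cost(3)[OF \<pi> l] by (intro ennreal_leI robust_wasserstein_le_cost \<pi> l)
  also have "\<dots> \<le> (\<integral>\<^sup>+z. ennreal (dist (fst z) (snd z)) \<partial>\<pi>)"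
    by (intro nn_integral_mono ennreal_leI) simp
  finally show "ennreal (robust_wasserstein l \<mu> \<nu>) \<le> (\<integral>\<^sup>+z. ennreal (dist (fst z) (snd z)) \<partial>\<pi>)" .
qed

section \<open>Passing to the limit of the truncation level\<close>

text \<open>
  The map \<open>k\<close> assigns to a point the first element of a dense sequence within distance \<open>e\<close>; its
  fibres are the cells and \<open>s i\<close> is the centre of the \<open>i\<close>-th cell.
\<close>

lemma small_cells:
  fixes e :: real
  assumes "e > 0"
  obtains k :: "'a::{metric_space, second_countable_topology} \<Rightarrow> nat" and s :: "nat \<Rightarrow> 'a"
  where "k \<in> borel \<rightarrow>\<^sub>M count_space UNIV" "\<And>x. dist x (s (k x)) < e"
proof -
  obtain D :: "'a set" where D: "countable D" "\<And>X. open X \<Longrightarrow> X \<noteq> {} \<Longrightarrow> \<exists>d\<in>D. d \<in> X"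
    using countable_dense_exists by metis
  define s where "s = from_nat_into D"
  define k where "k x = (LEAST i. dist x (s i) < e)" for x
  have ex: "\<exists>i. dist x (s i) < e" for x
  proof -
    obtain d where d: "d \<in> D" "d \<in> ball x e" using D(2)[of "ball x e"] \<open>e > 0\<close> by auto
    then obtain i where "s i = d"
      unfolding s_def using from_nat_into_surj[OF D(1)] by metis
    with d show ?thesis by auto
  qed
  have "k \<in> borel \<rightarrow>\<^sub>M count_space UNIV"
    unfolding k_def by measurable
  moreover have "dist x (s (k x)) < e" for x
    unfolding k_def by (rule LeastI_ex[OF ex])
  ultimately show ?thesis by (rule that)
qed

text \<open>
  This replaces weak compactness of the set of couplings.  Mass cannot escape to cells of large
  index because the fixed marginals dominate every row and every column.
\<close>

lemma couplings_cell_limit: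
  fixes \<mu> \<nu> :: "'a::second_countable_topology measure" and k :: "'a \<Rightarrow> nat" and \<pi> :: "nat \<Rightarrow> ('a \<times> 'a) measure"
  assumes \<mu>: "\<mu> \<in> borel_probs" and \<nu>: "\<nu> \<in> borel_probs"
    and k: "k \<in> borel \<rightarrow>\<^sub>M count_space UNIV"
    and \<pi>: "\<And>n. \<pi> n \<in> couplings \<mu> \<nu>"
  obtains r \<rho> where "strict_mono r" "\<rho> \<in> couplings \<mu> \<nu>"
    "\<forall>i j. (\<lambda>n. measure (\<pi> (r n)) (k -` {i} \<times> k -` {j})) \<longlonglongrightarrow> measure \<rho> (k -` {i} \<times> k -` {j})"
proof -
  interpret \<pi>: prob_space "\<pi> n" for n using \<pi> by (rule couplingsD)
  have cell: "k -` {i} \<in> sets borel" for i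
    using measurable_sets[OF k, of "{i}"] by simp
  define p where "p n c = measure (\<pi> n) (k -` {fst c} \<times> k -` {snd c})" for n c
  have "\<And>n c. p n c \<in> {0..1}" by (simp add: p_def)
  then obtain r q where r: "strict_mono r" and q: "\<And>c. (\<lambda>n. p (r n) c) \<longlonglongrightarrow> q c"
    using pointwise_convergent_subsequence[of p] by metis
  have q0: "q c \<ge> 0" for c
    using q[of c] by (rule LIMSEQ_le_const) (simp add: p_def)
  have p_eq: "ennreal (p n (i, j)) = emeasure (\<pi> n) (k -` {i} \<times> k -` {j})" for n i j
    by (simp add: p_def \<pi>.emeasure_eq_measure)
  have p_lim: "(\<lambda>n. ennreal (p (r n) (i, j))) \<longlonglongrightarrow> ennreal (q (i, j))" for i j
    using q by (rule tendsto_ennrealI)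
  have cells_total: "(\<integral>\<^sup>+i. emeasure M (k -` {i}) \<partial>count_space UNIV) < \<infinity>"
    if "M \<in> borel_probs" for M :: "'a measure"
  proof -
    interpret prob_space M using that by (rule borel_probsD)
    have "k \<in> M \<rightarrow>\<^sub>M count_space UNIV"
      using k borel_probsD(2)[OF that] by (simp add: measurable_cong_sets)
    from nn_integral_fibres[OF this, of "\<lambda>_. 1"] show ?thesis
      using emeasure_space_1 by (simp add: borel_probsD(3)[OF that])
  qed
  \<comment> \<open>The masses of the column cells dominate every row of every matrix in the sequence.\<close>
  have row: "(\<integral>\<^sup>+j. ennreal (q (i, j)) \<partial>count_space UNIV) = emeasure \<mu> (k -` {i})" for i
  proof -
    have "(\<lambda>n. \<integral>\<^sup>+j. ennreal (p (r n) (i, j)) \<partial>count_space UNIV)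
        \<longlonglongrightarrow> (\<integral>\<^sup>+j. ennreal (q (i, j)) \<partial>count_space UNIV)"
    proof (rule nn_integral_dominated_convergence[OF _ _ _ _ cells_total[OF \<nu>]])
      show "AE j in count_space UNIV. ennreal (p (r n) (i, j)) \<le> emeasure \<nu> (k -` {j})" for n
        unfolding p_eq sum_coupling_cells(2)[OF \<pi>[of "r n"] k, symmetric]
        by (auto intro!: nn_integral_ge_point)
    qed (auto intro: p_lim)
    moreover have "(\<integral>\<^sup>+j. ennreal (p (r n) (i, j)) \<partial>count_space UNIV) = emeasure \<mu> (k -` {i})" for n
      unfolding p_eq by (rule sum_coupling_cells(1)[OF \<pi> k])
    ultimately show ?thesis by (simp add: LIMSEQ_const_iff)
  qed
  have col: "(\<integral>\<^sup>+i. ennreal (q (i, j)) \<partial>count_space UNIV) = emeasure \<nu> (k -` {j})" for j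
  proof -
    have "(\<lambda>n. \<integral>\<^sup>+i. ennreal (p (r n) (i, j)) \<partial>count_space UNIV)
        \<longlonglongrightarrow> (\<integral>\<^sup>+i. ennreal (q (i, j)) \<partial>count_space UNIV)"
    proof (rule nn_integral_dominated_convergence[OF _ _ _ _ cells_total[OF \<mu>]])
      show "AE i in count_space UNIV. ennreal (p (r n) (i, j)) \<le> emeasure \<mu> (k -` {i})" for n
        unfolding p_eq sum_coupling_cells(1)[OF \<pi>[of "r n"] k, symmetric]
        by (auto intro!: nn_integral_ge_point)
    qed (auto intro: p_lim)
    moreover have "(\<integral>\<^sup>+i. ennreal (p (r n) (i, j)) \<partial>count_space UNIV) = emeasure \<nu> (k -` {j})" for n
      unfolding p_eq by (rule sum_coupling_cells(2)[OF \<pi> k])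
    ultimately show ?thesis by (simp add: LIMSEQ_const_iff)
  qed
  obtain \<rho> where \<rho>: "\<rho> \<in> couplings \<mu> \<nu>"
      "\<forall>i j. emeasure \<rho> (k -` {i} \<times> k -` {j}) = ennreal (q (i, j))"
    by (rule exists_coupling_with_cell_masses[OF \<mu> \<nu> k row col])
  have "(\<lambda>n. measure (\<pi> (r n)) (k -` {i} \<times> k -` {j})) \<longlonglongrightarrow> measure \<rho> (k -` {i} \<times> k -` {j})" for i j
    using q[of "(i, j)"] q0 by (simp add: p_def measure_def[of \<rho>] \<rho>(2))
  then show ?thesis by (intro that[OF r \<rho>(1)] allI)
qed

text \<open>
  Up to \<open>2 * e\<close>, the cost of a coupling is a sum over pairs of cells of mass times distance of
  centres.  Lower semicontinuity of the cost along the limit of couplings thereby becomes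
  Fatou's lemma on a countable index set.
\<close>

lemma wasserstein1_le_if_robust_le:
  fixes \<mu> \<nu> :: "'a::{metric_space, second_countable_topology} measure"
  assumes \<mu>: "\<mu> \<in> borel_probs" and \<nu>: "\<nu> \<in> borel_probs"
    and w: "\<And>n::nat. robust_wasserstein n \<mu> \<nu> \<le> w"
  shows "wasserstein1 \<mu> \<nu> \<le> ennreal w"
proof (rule ennreal_le_epsilon)
  fix \<epsilon> :: real assume "\<epsilon> > 0"
  \<comment> \<open>One \<open>e\<close> is lost to near-optimality of \<open>\<pi> n\<close>, two to replacing points by the centres of
    their cells, and two more to undoing this for the limit coupling.\<close>
  define e where "e = \<epsilon> / 5"
  have e: "e > 0" using \<open>\<epsilon> > 0\<close> by (simp add: e_def)
  have w0: "w \<ge> 0"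
    using robust_wasserstein_nonneg[OF \<mu> \<nu>, of 0] w[of 0] by simp
  have "\<exists>\<pi>\<in>couplings \<mu> \<nu>. (LINT z|\<pi>. min (dist (fst z) (snd z)) (2 * real n)) < w + e" for n
    using cInf_lessD[of "(\<lambda>\<pi>. LINT z|\<pi>. min (dist (fst z) (snd z)) (2 * real n)) ` couplings \<mu> \<nu>" "w + e"]
      w[of n] e couplings_nonempty[OF \<mu> \<nu>]
    by (auto simp: robust_wasserstein_def)
  then obtain \<pi> where \<pi>: "\<And>n. \<pi> n \<in> couplings \<mu> \<nu>"
    and \<pi>_cost: "\<And>n. (LINT z|\<pi> n. min (dist (fst z) (snd z)) (2 * real n)) < w + e"
    by metis
  interpret \<pi>: prob_space "\<pi> n" for n using \<pi> by (rule couplingsD)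
  obtain k :: "'a \<Rightarrow> nat" and s where k: "k \<in> borel \<rightarrow>\<^sub>M count_space UNIV"
    and s: "\<And>x. dist x (s (k x)) < e"
    using small_cells[OF e] by blast
  have near: "\<bar>dist (s (k x)) (s (k y)) - dist x y\<bar> \<le> 2 * e" for x y
    using s[of x] s[of y] dist_triangle[of x y "s (k x)"] dist_triangle[of "s (k x)" y "s (k y)"]
      dist_triangle[of "s (k x)" "s (k y)" x] dist_triangle[of x "s (k y)" y]
    by (simp add: dist_commute)
  obtain r \<rho> where r: "strict_mono r" and \<rho>: "\<rho> \<in> couplings \<mu> \<nu>"
    and lim: "\<forall>i j. (\<lambda>n. measure (\<pi> (r n)) (k -` {i} \<times> k -` {j}))
                 \<longlonglongrightarrow> measure \<rho> (k -` {i} \<times> k -` {j})"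
    by (rule couplings_cell_limit[where \<pi>=\<pi>, OF \<mu> \<nu> k \<pi>])
  interpret \<rho>: prob_space \<rho> using \<rho> by (rule couplingsD)
  define D where "D i j = dist (s i) (s j)" for i j
  define cell where "cell c = k -` {fst c} \<times> k -` {snd c}" for c
  have discrete_cost: "(\<integral>\<^sup>+c. ennreal (measure (\<pi> (r n)) (cell c) * min (D (fst c) (snd c)) (2 * real (r n)))
      \<partial>count_space UNIV) \<le> ennreal (w + 3 * e)" (is "?L n \<le> _") for n
  proof -
    let ?N = "r n"
    have "?L n = (\<integral>\<^sup>+z. ennreal (min (D (k (fst z)) (k (snd z))) (2 * real ?N)) \<partial>\<pi> ?N)"
      using nn_integral_coupling_cells(1)[OF \<pi>[of ?N] k, of "\<lambda>i j. ennreal (min (D i j) (2 * real ?N))"]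
      by (simp add: cell_def \<pi>.emeasure_eq_measure ennreal_mult D_def)
    also have "\<dots> \<le> (\<integral>\<^sup>+z. ennreal (min (dist (fst z) (snd z)) (2 * real ?N)) + ennreal (2 * e) \<partial>\<pi> ?N)"
    proof (rule nn_integral_mono)
      fix z
      have "min (D (k (fst z)) (k (snd z))) (2 * real ?N)
          \<le> min (dist (fst z) (snd z)) (2 * real ?N) + 2 * e"
        using near[of "fst z" "snd z"] e by (auto simp: D_def min_def)
      then show "ennreal (min (D (k (fst z)) (k (snd z))) (2 * real ?N))
          \<le> ennreal (min (dist (fst z) (snd z)) (2 * real ?N)) + ennreal (2 * e)"
        using e by (simp flip: ennreal_plus)
    qed
    also have "\<dots> = ennreal (LINT z|\<pi> ?N. min (dist (fst z) (snd z)) (2 * real ?N)) + ennreal (2 * e)"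
      using truncated_cost(1)[OF \<pi>[of ?N], of 0]
      by (subst nn_integral_add) (simp_all add: truncated_cost(3)[OF \<pi>] \<pi>.emeasure_space_1)
    also have "\<dots> \<le> ennreal (w + e) + ennreal (2 * e)"
      using \<pi>_cost[of ?N] by (intro add_right_mono ennreal_leI) simp
    also have "\<dots> = ennreal (w + 3 * e)"
      using w0 e by (simp flip: ennreal_plus)
    finally show ?thesis .
  qed
  \<comment> \<open>The truncation at \<open>2 * r n\<close> eventually exceeds any given distance of centres.\<close>
  have pointwise: "(\<lambda>n. ennreal (measure (\<pi> (r n)) (cell c) * min (D (fst c) (snd c)) (2 * real (r n))))
      \<longlonglongrightarrow> emeasure \<rho> (cell c) * ennreal (D (fst c) (snd c))" for c
  proof -
    have "\<forall>\<^sub>F n in sequentially. D (fst c) (snd c) \<le> 2 * real (r n)"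
    proof (rule eventually_sequentiallyI)
      fix n assume "nat \<lceil>D (fst c) (snd c)\<rceil> \<le> n"
      then show "D (fst c) (snd c) \<le> 2 * real (r n)"
        using seq_suble[OF r, of n] by linarith
    qed
    then have "\<forall>\<^sub>F n in sequentially. D (fst c) (snd c) = min (D (fst c) (snd c)) (2 * real (r n))"
      by eventually_elim simp
    then have "(\<lambda>n. min (D (fst c) (snd c)) (2 * real (r n))) \<longlonglongrightarrow> D (fst c) (snd c)"
      by (rule Lim_transform_eventually[OF tendsto_const])
    then have "(\<lambda>n. measure (\<pi> (r n)) (cell c) * min (D (fst c) (snd c)) (2 * real (r n)))
        \<longlonglongrightarrow> measure \<rho> (cell c) * D (fst c) (snd c)"
      unfolding cell_def by (intro tendsto_mult lim[rule_format])
    then show ?thesis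
      by (simp add: \<rho>.emeasure_eq_measure D_def flip: ennreal_mult)
  qed
  have "(\<integral>\<^sup>+z. ennreal (D (k (fst z)) (k (snd z))) \<partial>\<rho>)
      = (\<integral>\<^sup>+c. emeasure \<rho> (cell c) * ennreal (D (fst c) (snd c)) \<partial>count_space UNIV)"
    unfolding cell_def by (rule nn_integral_coupling_cells(1)[OF \<rho> k])
  also have "\<dots> = (\<integral>\<^sup>+c. liminf (\<lambda>n. ennreal (measure (\<pi> (r n)) (cell c)
                        * min (D (fst c) (snd c)) (2 * real (r n)))) \<partial>count_space UNIV)"
    by (simp add: lim_imp_Liminf[OF _ pointwise])
  also have "\<dots> \<le> liminf ?L"
    by (rule nn_integral_liminf) simp
  also have "\<dots> \<le> liminf (\<lambda>_. ennreal (w + 3 * e))"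
    by (rule Liminf_mono) (simp add: discrete_cost)
  also have "\<dots> = ennreal (w + 3 * e)"
    by (rule Liminf_const) simp
  finally have \<rho>_cost: "(\<integral>\<^sup>+z. ennreal (D (k (fst z)) (k (snd z))) \<partial>\<rho>) \<le> ennreal (w + 3 * e)" .
  have "wasserstein1 \<mu> \<nu> \<le> (\<integral>\<^sup>+z. ennreal (dist (fst z) (snd z)) \<partial>\<rho>)"
    unfolding wasserstein1_def by (rule INF_lower[OF \<rho>])
  also have "\<dots> \<le> (\<integral>\<^sup>+z. ennreal (D (k (fst z)) (k (snd z))) + ennreal (2 * e) \<partial>\<rho>)"
  proof (rule nn_integral_mono)
    fix z
    have "dist (fst z) (snd z) \<le> D (k (fst z)) (k (snd z)) + 2 * e"
      using near[of "fst z" "snd z"] by (auto simp: D_def)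
    then show "ennreal (dist (fst z) (snd z)) \<le> ennreal (D (k (fst z)) (k (snd z))) + ennreal (2 * e)"
      using e by (simp add: D_def flip: ennreal_plus)
  qed
  also have "\<dots> = (\<integral>\<^sup>+z. ennreal (D (k (fst z)) (k (snd z))) \<partial>\<rho>) + ennreal (2 * e)"
    using nn_integral_coupling_cells(2)[OF \<rho> k, of "\<lambda>i j. ennreal (D i j)"]
    by (subst nn_integral_add) (simp_all add: \<rho>.emeasure_space_1)
  also have "\<dots> \<le> ennreal (w + 3 * e) + ennreal (2 * e)"
    by (intro add_right_mono \<rho>_cost)
  also have "\<dots> = ennreal w + ennreal \<epsilon>"
    using w0 e \<open>\<epsilon> > 0\<close> by (simp add: e_def flip: ennreal_plus)
  finally show "wasserstein1 \<mu> \<nu> \<le> ennreal w + ennreal \<epsilon>" .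
qed

theorem theorem3p4:
  fixes \<mu> \<nu> :: "'a::polish_space measure"
  assumes "\<mu> \<in> borel_probs" and "\<nu> \<in> borel_probs"
  shows "continuous_on {0..} (\<lambda>l::real. robust_wasserstein l \<mu> \<nu>)
    \<and> mono_on {0..} (\<lambda>l::real. robust_wasserstein l \<mu> \<nu>)
    \<and> (wasserstein1 \<mu> \<nu> < \<infinity> \<longrightarrow>
         ((\<lambda>l::real. robust_wasserstein l \<mu> \<nu>) \<longlongrightarrow> enn2real (wasserstein1 \<mu> \<nu>)) at_top)"
proof (intro conjI impI)
  let ?W = "\<lambda>l::real. robust_wasserstein l \<mu> \<nu>"
  note mono = robust_wasserstein_mono[OF assms]
  show "mono_on {0..} ?W"
    by (intro mono_onI mono) auto
  have "2-lipschitz_on {0..} ?W"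
  proof (rule lipschitz_on_leI)
    fix l l' :: real assume "l \<in> {0..}" "l' \<in> {0..}" "l \<le> l'"
    then show "dist (?W l) (?W l') \<le> 2 * dist l l'"
      using mono[of l l'] robust_wasserstein_increment[OF assms, of l l'] by (simp add: dist_real_def)
  qed simp
  then show "continuous_on {0..} ?W"
    by (rule lipschitz_on_continuous_on)
  assume fin: "wasserstein1 \<mu> \<nu> < \<infinity>"
  then have W1: "wasserstein1 \<mu> \<nu> = ennreal (enn2real (wasserstein1 \<mu> \<nu>))"
    by simp
  show "(?W \<longlongrightarrow> enn2real (wasserstein1 \<mu> \<nu>)) at_top"
  proof (rule order_tendstoI)
    fix a assume a: "a < enn2real (wasserstein1 \<mu> \<nu>)"
    have "\<exists>n::nat. a < ?W n"
    proof (rule ccontr)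
      assume "\<not> (\<exists>n::nat. a < ?W n)"
      then have le: "?W (real n) \<le> a" for n
        by (simp add: not_less)
      have "0 \<le> a"
        using robust_wasserstein_nonneg[OF assms, of 0] le[of 0] by simp
      have "wasserstein1 \<mu> \<nu> \<le> ennreal a"
        by (rule wasserstein1_le_if_robust_le[OF assms le])
      then have "enn2real (wasserstein1 \<mu> \<nu>) \<le> a"
        using \<open>0 \<le> a\<close> by (intro enn2real_leI)
      with a show False by simp
    qed
    then obtain n :: nat where n: "a < ?W n" by blast
    have "a < ?W l" if "real n \<le> l" for l
      using n mono[of "real n" l] that by simp
    then show "\<forall>\<^sub>F l in at_top. a < ?W l"
      by (auto simp: eventually_at_top_linorder)
  next
    fix a assume a: "enn2real (wasserstein1 \<mu> \<nu>) < a"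
    have "?W l \<le> enn2real (wasserstein1 \<mu> \<nu>)" if "0 \<le> l" for l
      using robust_wasserstein_le_wasserstein1[OF that, of \<mu> \<nu>] W1
      by (metis enn2real_nonneg ennreal_le_iff)
    with a show "\<forall>\<^sub>F l in at_top. ?W l < a"
      by (auto simp: eventually_at_top_linorder intro!: exI[of _ 0] intro: le_less_trans)
  qed
qed

end
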